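(* Let $N$ be an odd perfect number, let $q$ be a prime and let $\alpha\ge 1$ be an integer such that $q^{\alpha}\,\|\, N$. Then $$\frac{\sigma(N/q^{\alpha})}{q^{\alpha}}>5.$$
   Context: For a positive integer $n$, $\sigma(n)$ denotes the sum of the positive divisors of $n$. A positive integer $N$ is perfect if $\sigma(N)=2N$. The notation $q^{\alpha}\,\|\,N$ means that $q^{\alpha}\mid N$ but $q^{\alpha+1}\nmid N$. *)

theory Defs
  imports Complex_Main "HOL-Number_Theory.Number_Theory"
begin

definition divisor_sum :: "nat \<Rightarrow> nat" where
  "divisor_sum n = (\<Sum>d | d dvd n. d)"

text \<open>Positivity is explicit because \<open>divisor_sum 0 = 0\<close>: the set of divisors of \<open>0\<close> is infinite.\<close>

definition perfect_number :: "nat \<Rightarrow> bool" where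
  "perfect_number N \<longleftrightarrow> N > 0 \<and> divisor_sum N = 2 * N"

definition exact_power_dvd :: "nat \<Rightarrow> nat \<Rightarrow> nat \<Rightarrow> bool" where
  "exact_power_dvd q a N \<longleftrightarrow> q ^ a dvd N \<and> \<not> q ^ (a + 1) dvd N"

end

theory Submission
  imports Defs
begin

text \<open>
  Write \<open>\<sigma>\<close> for the divisor sum, \<open>M = N / q ^ \<alpha>\<close> and \<open>\<sigma> M = m * q ^ \<alpha>\<close>; then
  \<open>m * \<sigma> (q ^ \<alpha>) = 2 * M\<close>, and parity excludes \<open>m = 0\<close> and \<open>m = 4\<close>. The case \<open>m = 2\<close> is settled by
  comparing \<open>M\<close> with its prime powers modulo \<open>q\<close>.

  If \<open>m\<close> is 1, 3 or 5, then \<open>n = \<alpha> + 1\<close> is twice an odd number, \<open>M\<close> is a square, and at most one of the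
  prime powers \<open>p ^ b\<close> exactly dividing \<open>M\<close> has \<open>\<sigma> (p ^ b)\<close> divisible by \<open>m\<close> (none if \<open>m = 1\<close>); for the
  others \<open>\<sigma> (p ^ b)\<close> is a power of \<open>q\<close>, which by a size estimate forces \<open>p\<close> to divide \<open>n * m\<close> or \<open>q - 1\<close>.
  If \<open>n > 2\<close>, let \<open>r\<close> be the largest odd prime dividing \<open>n\<close>: both \<open>(q ^ r - 1) / (q - 1)\<close> and
  \<open>(q ^ r + 1) / (q + 1)\<close> have a prime divisor congruent to 1 modulo \<open>r\<close>, and these two primes are
  distinct exceptions. If \<open>n = 2\<close>, every \<open>\<sigma> (p ^ b)\<close> is divisible by \<open>q\<close>, so \<open>M\<close> is a prime power.
\<close>


section \<open>Divisor sums: multiplicativity, prime powers, factorization\<close>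

text \<open>By coprimality each divisor of \<open>a * b\<close> splits uniquely as
  \<open>x * y\<close> with \<open>x dvd a\<close> and \<open>y dvd b\<close>; the sum over pairs
  then factors by distributivity.\<close>

lemma divisor_sum_mult:
  assumes "coprime a b" "a > 0" "b > 0"
  shows "divisor_sum (a * b) = divisor_sum a * divisor_sum b"
proof -
  have "bij_betw (\<lambda>(x, y). x * y) ({d. d dvd a} \<times> {d. d dvd b}) {d. d dvd a * b}"
  proof (rule bij_betwI')
    fix u v assume "u \<in> {d. d dvd a} \<times> {d. d dvd b}" "v \<in> {d. d dvd a} \<times> {d. d dvd b}"
    moreover obtain x y x' y' where uv: "u = (x, y)" "v = (x', y')"
      by (metis surj_pair)
    ultimately have d: "x dvd a" "y dvd b" "x' dvd a" "y' dvd b" by auto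
    show "((\<lambda>(x, y). x * y) u = (\<lambda>(x, y). x * y) v) = (u = v)"
    proof
      assume "(\<lambda>(x, y). x * y) u = (\<lambda>(x, y). x * y) v"
      then have e: "x * y = x' * y'" by (simp add: uv)
      have c: "coprime x y'" "coprime x' y"
        using d assms(1) by (meson coprime_divisors)+
      have "x dvd x'" "x' dvd x"
        using e c by (metis coprime_dvd_mult_left_iff dvd_triv_left)+
      then have "x = x'" by (rule dvd_antisym)
      moreover have "x \<noteq> 0" using d assms(2) by auto
      ultimately show "u = v" using e by (simp add: uv)
    qed auto
  next
    fix u assume "u \<in> {d. d dvd a} \<times> {d. d dvd b}"
    then show "(\<lambda>(x, y). x * y) u \<in> {d. d dvd a * b}" by (auto intro: mult_dvd_mono)
  next
    fix d assume "d \<in> {d. d dvd a * b}"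
    then obtain x y where "d = x * y" "x dvd a" "y dvd b"
      using division_decomp by blast
    then show "\<exists>u \<in> {d. d dvd a} \<times> {d. d dvd b}. d = (\<lambda>(x, y). x * y) u"
      by (intro bexI[of _ "(x, y)"]) auto
  qed
  then have "divisor_sum (a * b) = (\<Sum>(x, y) \<in> {d. d dvd a} \<times> {d. d dvd b}. x * y)"
    unfolding divisor_sum_def by (subst sum.reindex_bij_betw[symmetric]) (auto simp: case_prod_unfold)
  then show ?thesis
    by (simp add: divisor_sum_def sum_product sum.cartesian_product)
qed

lemma divisor_sum_prime_power:
  assumes "prime p"
  shows "divisor_sum (p ^ b) = (\<Sum>i\<le>b. p ^ i)"
proof -
  have "{d. d dvd p ^ b} = (\<lambda>i. p ^ i) ` {..b}"
    using divides_primepow_nat[OF assms] by auto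
  moreover have "inj_on (\<lambda>i. p ^ i) {..b}"
    using prime_gt_1_nat[OF assms] by (auto intro!: inj_onI)
  ultimately show ?thesis
    by (simp add: divisor_sum_def sum.reindex)
qed

text \<open>The geometric series in a form without division, and with 1 on the left, so that the
  identity can be reduced modulo primes without subtracting naturals.\<close>

lemma divisor_sum_prime_power_eq:
  assumes "prime p"
  shows "(p - 1) * divisor_sum (p ^ b) + 1 = p ^ Suc b"
proof -
  obtain k where k: "p = Suc k" using prime_gt_0_nat[OF assms] gr0_conv_Suc by blast
  have "k * (\<Sum>i\<le>b. Suc k ^ i) + 1 = Suc k ^ Suc b"
    by (induction b) (auto simp: algebra_simps)
  then show ?thesis
    by (simp only: divisor_sum_prime_power[OF assms]) (simp add: k)
qed

lemma divisor_sum_prime_power_cong_1: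
  assumes "prime p"
  shows "[divisor_sum (p ^ b) = 1] (mod p)"
proof -
  have "(\<Sum>i\<le>b. p ^ i) = 1 + p * (\<Sum>i<b. p ^ i)"
    by (subst sum.atMost_shift) (simp add: sum_distrib_left)
  moreover have "[1 + p * (\<Sum>i<b. p ^ i) = 1 + 0] (mod p)"
    by (intro cong_add) (auto simp: cong_0_iff)
  ultimately show ?thesis
    by (simp add: divisor_sum_prime_power[OF assms])
qed

lemma divisor_sum_prime_power_gt:
  assumes "prime p" "b > 0"
  shows "p ^ b < divisor_sum (p ^ b)"
proof -
  have "(\<Sum>i\<in>{0, b}. p ^ i) \<le> (\<Sum>i\<le>b. p ^ i)"
    by (intro sum_mono2) auto
  then show ?thesis
    using assms(2) by (simp add: divisor_sum_prime_power[OF assms(1)])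
qed

text \<open>The sum consists of \<open>b + 1\<close> odd terms.\<close>

lemma even_divisor_sum_odd_prime_power:
  assumes "prime p" "odd p"
  shows "even (divisor_sum (p ^ b)) \<longleftrightarrow> odd b"
  unfolding divisor_sum_prime_power[OF assms(1)] using assms(2) by (induction b) auto

text \<open>For odd \<open>b\<close> the powers pair off as \<open>p ^ (2*i) + p ^ (2*i+1)\<close>,
  each pair being a multiple of \<open>p + 1\<close>.\<close>

lemma Suc_dvd_divisor_sum_prime_power:
  assumes "prime p" "odd b"
  shows "Suc p dvd divisor_sum (p ^ b)"
proof -
  obtain c where "b = 2 * c + 1" using assms(2) oddE by blast
  moreover have "(\<Sum>i\<le>2*c+1. p ^ i) = Suc p * (\<Sum>i\<le>c. p ^ (2*i))" for c
    by (induction c) (auto simp: algebra_simps)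
  ultimately show ?thesis by (simp only: divisor_sum_prime_power[OF assms(1)] dvd_triv_left)
qed

lemma divisor_sum_prod_prime_powers:
  assumes "finite A" "\<And>p. p \<in> A \<Longrightarrow> prime p"
  shows "divisor_sum (\<Prod>p\<in>A. p ^ f p) = (\<Prod>p\<in>A. divisor_sum (p ^ f p))"
  using assms
proof (induction A rule: finite_induct)
  case empty
  show ?case by (simp add: divisor_sum_def)
next
  case (insert x A)
  have "coprime (x ^ f x) (p ^ f p)" if "p \<in> A" for p
    using that insert.hyps insert.prems by (metis coprime_power_left_iff coprime_power_right_iff insertI1 insertI2 primes_coprime)
  then have "coprime (x ^ f x) (\<Prod>p\<in>A. p ^ f p)"
    by (intro prod_coprime_right) auto
  then have "divisor_sum (x ^ f x * (\<Prod>p\<in>A. p ^ f p)) =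
      divisor_sum (x ^ f x) * divisor_sum (\<Prod>p\<in>A. p ^ f p)"
    using insert.prems by (intro divisor_sum_mult prod_pos) (auto simp: prime_gt_0_nat)
  moreover have "divisor_sum (\<Prod>p\<in>A. p ^ f p) = (\<Prod>p\<in>A. divisor_sum (p ^ f p))"
    using insert.IH insert.prems by blast
  ultimately show ?case by (simp only: prod.insert[OF insert.hyps])
qed

lemma divisor_sum_prime_factorization:
  assumes "M > 0"
  shows "divisor_sum M = (\<Prod>p\<in>prime_factors M. divisor_sum (p ^ multiplicity p M))"
proof -
  have "M = (\<Prod>p\<in>prime_factors M. p ^ multiplicity p M)"
    using assms by (rule prime_factorization_nat)
  then show ?thesis
    using divisor_sum_prod_prime_powers[of "prime_factors M" "\<lambda>p. multiplicity p M"] by auto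
qed

lemma divisor_sum_prime_part_dvd:
  assumes "M > 0" "p \<in> prime_factors M"
  shows "divisor_sum (p ^ multiplicity p M) dvd divisor_sum M"
  unfolding divisor_sum_prime_factorization[OF assms(1)]
  using assms(2) by (intro dvd_prodI) auto

text \<open>Serves to show that exceptional primes are unique: a factor shared by two prime parts
  would divide \<open>divisor_sum M\<close> twice.\<close>

lemma divisor_sum_two_prime_parts_dvd:
  assumes "M > 0" "p \<in> prime_factors M" "s \<in> prime_factors M" "p \<noteq> s"
  shows "divisor_sum (p ^ multiplicity p M) * divisor_sum (s ^ multiplicity s M) dvd divisor_sum M"
proof -
  have "(\<Prod>x\<in>{p, s}. divisor_sum (x ^ multiplicity x M)) dvd divisor_sum M"
    unfolding divisor_sum_prime_factorization[OF assms(1)]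
    using assms by (intro prod_dvd_prod_subset) auto
  then show ?thesis using assms(4) by simp
qed

section \<open>Prime divisors of (x^r - 1) / (x - 1)\<close>

text \<open>With \<open>x = 1 + r * t\<close>, only the linear term of \<open>x ^ j\<close> survives
  modulo \<open>r\<^sup>2\<close>. The linear terms add up to
  \<open>r * t * (r * (r - 1) / 2)\<close>, a multiple of \<open>r\<^sup>2\<close> because
  \<open>r\<close> is odd.\<close>

lemma geometric_sum_cong:
  fixes x :: int and r :: nat
  assumes "odd r" "[x = 1] (mod int r)"
  shows "[(\<Sum>j<r. x ^ j) = int r] (mod (int r)\<^sup>2)"
proof -
  obtain t where t: "x = 1 + int r * t"
    using assms(2) by (metis cong_iff_lin cong_sym)
  obtain h where h: "r = 2 * h + 1" using assms(1) oddE by blast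
  have "[x ^ j = 1 + int j * (int r * t)] (mod (int r)\<^sup>2)" for j
  proof (induction j)
    case (Suc j)
    have "[x * x ^ j = x * (1 + int j * (int r * t))] (mod (int r)\<^sup>2)"
      using Suc cong_scalar_left by blast
    also have "x * (1 + int j * (int r * t)) =
        1 + int (Suc j) * (int r * t) + (int r)\<^sup>2 * (int j * t\<^sup>2)"
      by (simp add: t algebra_simps power2_eq_square)
    also have "[\<dots> = 1 + int (Suc j) * (int r * t)] (mod (int r)\<^sup>2)"
      by (simp add: cong_def)
    finally show ?case by simp
  qed simp
  then have "[(\<Sum>j<r. x ^ j) = (\<Sum>j<r. 1 + int j * (int r * t))] (mod (int r)\<^sup>2)"
    by (intro cong_sum)
  also have "(\<Sum>j<r. 1 + int j * (int r * t)) = int r + (\<Sum>j<r. int j) * (int r * t)"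
    by (simp add: sum.distrib sum_distrib_right)
  also have "(\<Sum>j<r. int j) = int r * int h"
  proof -
    have "2 * (\<Sum>j<n. int j) = int n * (int n - 1)" for n
      by (induction n) (auto simp: algebra_simps)
    from this[of r] show ?thesis by (simp add: h)
  qed
  also have "int r + int r * int h * (int r * t) = int r + (int r)\<^sup>2 * (int h * t)"
    by (simp add: algebra_simps power2_eq_square)
  also have "[\<dots> = int r] (mod (int r)\<^sup>2)"
    by (simp add: cong_def)
  finally show ?thesis .
qed

text \<open>The sum contains the prime \<open>r\<close> at most once, so its size forces another
  prime divisor \<open>p\<close>; modulo \<open>p\<close> the order of \<open>x\<close> is exactly
  \<open>r\<close>, which therefore divides \<open>p - 1\<close>. Integers are used so that
  \<open>x\<close> may be negative.\<close>

lemma prime_divisor_geometric_sum: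
  fixes x :: int and r :: nat
  assumes r: "prime r" "odd r" and big: "int r < \<bar>\<Sum>j<r. x ^ j\<bar>"
  obtains p :: nat where "prime p" "[p = 1] (mod r)" "[x ^ r = 1] (mod int p)" "\<not> [x = 1] (mod int p)"
proof -
  define C where "C = (\<Sum>j<r. x ^ j)"
  have C: "(x - 1) * C = x ^ r - 1"
    unfolding C_def by (simp add: power_diff_1_eq)
  have "C \<noteq> 0" using big C_def by auto
  \<comment> \<open>If \<open>r\<close> divides \<open>C\<close>, then \<open>x ^ r\<close> is 1
    modulo \<open>r\<close>, and Fermat gives \<open>x\<close> congruent to 1, so \<open>C\<close>
    is \<open>r\<close> modulo \<open>r\<^sup>2\<close>.\<close>
  have r2: "\<not> (int r)\<^sup>2 dvd C"
  proof
    assume *: "(int r)\<^sup>2 dvd C"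
    then have "int r dvd C" by (metis dvd_mult_left power2_eq_square)
    then have "[x ^ r = 1] (mod int r)" using C
      by (metis cong_iff_dvd_diff dvd_mult)
    moreover have "[x ^ r = x] (mod int r)"
    proof (cases "int r dvd x")
      case True
      then show ?thesis using prime_gt_0_nat[OF r(1)] by (simp add: cong_def mod_eq_0_iff_dvd dvd_trans[OF _ dvd_power])
    next
      case False
      define y where "y = nat (x mod int r)"
      have y: "[int y = x] (mod int r)" using prime_gt_0_nat[OF r(1)] by (simp add: y_def cong_def)
      have "\<not> int r dvd int y" using False y cong_dvd_iff cong_sym by blast
      then have "\<not> r dvd y" by simp
      then have "[y ^ (r - 1) = 1] (mod r)" using fermat_theorem r by blast
      then have "[int y ^ (r - 1) = 1] (mod int r)"
        by (metis cong_int_iff of_nat_1 of_nat_power)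
      then have "[x ^ (r - 1) = 1] (mod int r)"
        using y by (meson cong_pow cong_sym cong_trans)
      then have "[x * x ^ (r - 1) = x * 1] (mod int r)" using cong_scalar_left by blast
      then show ?thesis using prime_gt_0_nat[OF r(1)] by (simp add: power_eq_if)
    qed
    ultimately have "[x = 1] (mod int r)" using cong_sym cong_trans by blast
    then have "[C = int r] (mod (int r)\<^sup>2)" unfolding C_def by (rule geometric_sum_cong[OF r(2)])
    then have "(int r)\<^sup>2 dvd int r" using * cong_dvd_iff cong_sym by blast
    then have "(int r)\<^sup>2 \<le> int r" using prime_gt_0_nat[OF r(1)] by (intro zdvd_imp_le) auto
    then show False using prime_gt_1_nat[OF r(1)] by (simp add: power2_eq_square)
  qed
  \<comment> \<open>Otherwise \<open>\<bar>C\<bar>\<close> would be 1 or \<open>r\<close>, against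
    \<open>big\<close>.\<close>
  have "\<exists>p. prime p \<and> p \<noteq> r \<and> int p dvd C"
  proof (rule ccontr)
    assume "\<not> ?thesis"
    then have *: "\<And>p. prime p \<Longrightarrow> p dvd nat \<bar>C\<bar> \<Longrightarrow> p = r" by auto
    have "nat \<bar>C\<bar> \<noteq> 0" using \<open>C \<noteq> 0\<close> by simp
    then obtain c where c: "nat \<bar>C\<bar> = r ^ multiplicity r (nat \<bar>C\<bar>) * c" "\<not> r dvd c"
      using r(1) by (metis multiplicity_decompose' not_prime_unit)
    have "c = 1"
    proof (rule ccontr)
      assume "c \<noteq> 1"
      then obtain p where "prime p" "p dvd c" using prime_factor_nat by blast
      then show False using * c by (metis dvd_mult)
    qed
    define a where "a = multiplicity r (nat \<bar>C\<bar>)"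
    have C': "nat \<bar>C\<bar> = r ^ a" using c(1) \<open>c = 1\<close> unfolding a_def by simp
    have "a < 2"
    proof (rule ccontr)
      assume "\<not> a < 2"
      then have "r\<^sup>2 dvd nat \<bar>C\<bar>" unfolding C' by (intro le_imp_power_dvd) auto
      then show False using r2 by auto
    qed
    then have "r ^ a \<le> r ^ 1" using prime_gt_0_nat[OF r(1)] by (intro power_increasing) auto
    then show False using big C' unfolding C_def by simp
  qed
  then obtain p where p: "prime p" "p \<noteq> r" "int p dvd C" by blast
  have x: "[x ^ r = 1] (mod int p)" using C p(3) by (metis cong_iff_dvd_diff dvd_mult)
  have nx: "\<not> [x = 1] (mod int p)"
  proof
    assume "[x = 1] (mod int p)"
    then have "[C = (\<Sum>j<r. 1 ^ j)] (mod int p)" unfolding C_def by (intro cong_sum cong_pow)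
    then have "int p dvd int r" using p(3) cong_dvd_iff by fastforce
    then show False using p r primes_dvd_imp_eq by auto
  qed
  \<comment> \<open>A natural representative of \<open>x\<close>, since \<open>ord\<close> and
    Fermat's theorem are applied over \<open>nat\<close>.\<close>
  define y where "y = nat (x mod int p)"
  have y: "[int y = x] (mod int p)" using prime_gt_0_nat[OF p(1)] by (simp add: y_def cong_def)
  have "[int y ^ r = 1] (mod int p)" using x y by (meson cong_pow cong_trans)
  then have yr: "[y ^ r = 1] (mod p)" by (metis cong_int_iff of_nat_1 of_nat_power)
  have "\<not> [int y = int 1] (mod int p)" using nx y cong_sym cong_trans by fastforce
  then have y1: "\<not> [y = 1] (mod p)" using cong_int_iff by blast
  have "ord p y dvd r" using yr ord_divides by blast
  moreover have "ord p y \<noteq> 1" using y1 by (simp add: ord_eq_Suc_0_iff)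
  ultimately have "ord p y = r" using r(1) prime_nat_iff by blast
  moreover have "\<not> p dvd y"
  proof
    assume "p dvd y"
    then have "p dvd y ^ r" using prime_gt_0_nat[OF r(1)] by (simp add: dvd_power_iff_le dvd_trans[OF _ dvd_power])
    then have "p dvd 1" using yr cong_dvd_iff by blast
    then show False using p(1) not_prime_unit by blast
  qed
  ultimately have "r dvd p - 1" using fermat_theorem[OF p(1)] ord_divides by metis
  then have "[p = 1] (mod r)"
    using prime_gt_0_nat[OF p(1)] by (subst cong_altdef_nat) auto
  then show ?thesis using that p(1) x nx by blast
qed


section \<open>The index 2\<close>

lemma odd_order_prod:
  fixes f :: "'a \<Rightarrow> nat"
  assumes "finite A" "\<And>x. x \<in> A \<Longrightarrow> \<exists>R. odd R \<and> [f x ^ R = 1] (mod q)"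
  shows "\<exists>R. odd R \<and> [(\<Prod>x\<in>A. f x) ^ R = 1] (mod q)"
  using assms
proof (induction A rule: finite_induct)
  case empty
  show ?case by (auto intro: exI[of _ 1])
next
  case (insert x A)
  then obtain R S where R: "odd R" "[f x ^ R = 1] (mod q)"
    and S: "odd S" "[(\<Prod>x\<in>A. f x) ^ S = 1] (mod q)" by blast
  have "[(f x ^ R) ^ S * ((\<Prod>x\<in>A. f x) ^ S) ^ R = 1 ^ S * 1 ^ R] (mod q)"
    using R(2) S(2) by (intro cong_mult cong_pow)
  then have "[(\<Prod>x\<in>insert x A. f x) ^ (R * S) = 1] (mod q)"
    using insert.hyps by (simp add: power_mult_distrib power_mult[symmetric] mult.commute)
  then show ?case using R(1) S(1) even_mult_iff by blast
qed

text \<open>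
  Every prime power exactly dividing \<open>M\<close> with even exponent has odd order modulo \<open>q\<close>, and the
  unique one with odd exponent is congruent to \<open>-1\<close>; so an odd power of \<open>M\<close> is congruent to \<open>-1\<close>,
  although \<open>M = divisor_sum (q ^ \<alpha>)\<close> is congruent to \<open>1\<close>.
\<close>

lemma no_even_index_two:
  assumes q: "prime q" "odd q" and M: "odd M"
    and 1: "divisor_sum (q ^ \<alpha>) = M" and 2: "divisor_sum M = 2 * q ^ \<alpha>"
  shows False
proof -
  define s where "s x = divisor_sum (x ^ multiplicity x M)" for x
  have M0: "M > 0" using M odd_pos by blast
  have sM: "divisor_sum M = (\<Prod>x\<in>prime_factors M. s x)"
    unfolding s_def using M0 by (rule divisor_sum_prime_factorization)
  have pf: "prime x" "odd x" if "x \<in> prime_factors M" for x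
    using that M by (auto simp: in_prime_factors_iff)
  have "even (\<Prod>x\<in>prime_factors M. s x)" using 2 sM by simp
  then obtain p where p: "p \<in> prime_factors M" "even (s p)"
    by (auto simp: even_prod_iff)
  \<comment> \<open>A second even factor would make 4 divide
    \<open>2 * q ^ \<alpha>\<close>.\<close>
  have s_odd: "odd (s x)" if "x \<in> prime_factors M" "x \<noteq> p" for x
  proof
    assume "even (s x)"
    then have "2 * 2 dvd s x * s p" using p(2) by (intro mult_dvd_mono)
    also have "s x * s p dvd divisor_sum M"
      unfolding s_def using that p M0 by (intro divisor_sum_two_prime_parts_dvd) auto
    finally have "even (q ^ \<alpha>)" using 2 by simp
    then show False using q by simp
  qed
  have q_dvd: "q dvd t" if "t dvd q ^ \<alpha>" "t \<noteq> 1" for t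
    using that q divides_primepow_nat[of q t \<alpha>]
    by (metis dvd_power gr0I power_0)
  have "\<exists>R. odd R \<and> [(x ^ multiplicity x M) ^ R = 1] (mod q)"
    if x: "x \<in> prime_factors M - {p}" for x
  proof -
    define b where "b = multiplicity x M"
    have b: "b > 0" using x by (auto simp: b_def prime_factors_multiplicity)
    have "even b"
      using s_odd[of x] even_divisor_sum_odd_prime_power[of x b] pf[of x] x by (auto simp: s_def b_def)
    \<comment> \<open>As an odd divisor of \<open>2 * q ^ \<alpha>\<close> other than 1,
      \<open>s x\<close> is a multiple of \<open>q\<close>; hence \<open>x ^ Suc b\<close> is 1
      modulo \<open>q\<close>, with \<open>Suc b\<close> odd.\<close>
    have "s x dvd 2 * q ^ \<alpha>"
      using divisor_sum_prime_part_dvd[OF M0, of x] x 2 by (simp add: s_def)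
    then have "s x dvd q ^ \<alpha>"
      using s_odd[of x] x by (simp add: coprime_dvd_mult_right_iff)
    moreover have "s x \<noteq> 1"
      using divisor_sum_prime_power_gt[of x b] pf(1)[of x] x b prime_gt_0_nat[of x]
      by (auto simp: s_def b_def[symmetric])
    ultimately have "q dvd s x" using q_dvd by blast
    then have "[(x - 1) * s x + 1 = 0 + 1] (mod q)"
      by (intro cong_add) (auto simp: cong_0_iff)
    then have "[x ^ Suc b = 1] (mod q)"
      using divisor_sum_prime_power_eq[of x b] pf(1)[of x] x by (simp add: s_def b_def)
    then have "[(x ^ Suc b) ^ b = 1 ^ b] (mod q)" by (rule cong_pow)
    then have "[(x ^ b) ^ Suc b = 1] (mod q)"
      by (simp only: power_mult[symmetric] mult.commute power_one)
    then show ?thesis using \<open>even b\<close> b_def by (intro exI[of _ "Suc b"]) auto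
  qed
  then obtain R where R: "odd R" "[(\<Prod>x\<in>prime_factors M - {p}. x ^ multiplicity x M) ^ R = 1] (mod q)"
    using odd_order_prod[of "prime_factors M - {p}" "\<lambda>x. x ^ multiplicity x M" q] by auto
  define K where "K = (\<Prod>x\<in>prime_factors M - {p}. x ^ multiplicity x M)"
  define b where "b = multiplicity p M"
  have MK: "M = p ^ b * K"
    using prime_factorization_nat[OF M0] p(1) unfolding K_def b_def
    by (subst (asm) prod.remove[of _ p]) auto
  have "odd b"
    using p even_divisor_sum_odd_prime_power[of p b] pf[of p] by (auto simp: s_def b_def)
  \<comment> \<open>Half of \<open>p + 1\<close> divides \<open>q ^ \<alpha>\<close> and is not 1,
    so \<open>q\<close> divides \<open>p + 1\<close>.\<close>
  have "Suc p dvd 2 * q ^ \<alpha>"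
    using Suc_dvd_divisor_sum_prime_power[of p b] pf[of p] p(1) \<open>odd b\<close>
      divisor_sum_prime_part_dvd[OF M0 p(1)] 2 dvd_trans by (auto simp: b_def)
  moreover obtain t where t: "Suc p = 2 * t" using pf(2)[OF p(1)] by (metis evenE even_Suc)
  ultimately have "t dvd q ^ \<alpha>" by simp
  moreover have "t \<noteq> 1" using t pf(1)[OF p(1)] prime_gt_1_nat[of p] by auto
  ultimately have "q dvd Suc p" using q_dvd t by simp
  then have p1: "[int p = - 1] (mod int q)"
    by (simp add: cong_iff_dvd_diff) (metis int_dvd_int_iff of_nat_Suc add.commute)
  have "[int K ^ R = 1] (mod int q)"
    using R(2) unfolding K_def[symmetric] by (metis cong_int_iff of_nat_1 of_nat_power)
  then have "[(int p ^ b) ^ R * int K ^ R = ((- 1) ^ b) ^ R * 1] (mod int q)"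
    using p1 by (intro cong_mult cong_pow)
  then have "[int M ^ R = - 1] (mod int q)"
    using R(1) \<open>odd b\<close> by (simp add: MK power_mult_distrib)
  moreover have "[int M = 1] (mod int q)"
    using divisor_sum_prime_power_cong_1[OF q(1), of \<alpha>] 1 by (metis cong_int_iff of_nat_1)
  then have "[int M ^ R = 1 ^ R] (mod int q)" by (rule cong_pow)
  then have "[1 = int M ^ R] (mod int q)" by (simp add: cong_sym)
  ultimately have "[1 = - 1] (mod int q)" by (metis cong_trans)
  then have "int q dvd 2" by (simp add: cong_iff_dvd_diff)
  then have "q dvd 2" by (metis int_dvd_int_iff of_nat_numeral)
  then have "q \<le> 2" by (rule dvd_imp_le) simp
  then show False using q prime_ge_2_nat[of q] by auto
qed

section \<open>The indices 1, 3 and 5\<close>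

text \<open>
  The order \<open>d\<close> of \<open>q\<close> modulo \<open>p\<close> divides both \<open>l\<close> and \<open>\<alpha> + 1\<close>, and \<open>p ^ b\<close> divides
  \<open>(q ^ d - 1) / (q - 1)\<close>. This makes \<open>p ^ b\<close> smaller than \<open>q ^ l / 2\<close>, whereas
  \<open>divisor_sum (p ^ b) < 2 * p ^ b\<close>.
\<close>

lemma new_prime_divisor_contradiction:
  assumes p: "prime p" and q: "prime q" "odd q" and b: "b > 0"
    and dvd: "p ^ b dvd divisor_sum (q ^ \<alpha>)"
    and n: "\<not> p dvd Suc \<alpha>" and q1: "\<not> [q = 1] (mod p)"
    and l: "divisor_sum (p ^ b) = q ^ l"
  shows False
proof -
  define d where "d = ord p q"
  have q3: "q \<ge> 3" using q prime_ge_2_nat[of q] by (cases "q = 2") auto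
  have pS: "(q - 1) * divisor_sum (q ^ \<alpha>) + 1 = q ^ Suc \<alpha>"
    using divisor_sum_prime_power_eq[OF q(1)] .
  have pd: "p dvd divisor_sum (q ^ \<alpha>)" using dvd b by (metis dvd_power dvd_trans)
  have "[(q - 1) * divisor_sum (q ^ \<alpha>) + 1 = 0 + 1] (mod p)"
    using pd by (intro cong_add) (auto simp: cong_0_iff)
  then have "[q ^ Suc \<alpha> = 1] (mod p)" using pS by simp
  then have "d dvd Suc \<alpha>" unfolding d_def by (simp only: ord_divides)
  then obtain e where e: "Suc \<alpha> = d * e" by blast
  have "[q ^ l = 1] (mod p)" using divisor_sum_prime_power_cong_1[OF p, of b] l by simp
  then have "d dvd l" unfolding d_def by (simp only: ord_divides)
  moreover have pb: "(p - 1) * q ^ l + 1 = p * p ^ b"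
    using divisor_sum_prime_power_eq[OF p, of b] l by simp
  have pb1: "p ^ b > 1" using one_less_power[OF prime_gt_1_nat[OF p] b] .
  have "l \<noteq> 0"
  proof
    assume "l = 0"
    then have "p = p * p ^ b" using pb prime_gt_0_nat[OF p] by simp
    then show False using pb1 prime_gt_0_nat[OF p] by simp
  qed
  ultimately have "d \<le> l" by (simp add: dvd_imp_le)
  \<comment> \<open>\<open>G\<close> is the cofactor of \<open>q ^ d - 1\<close> in
    \<open>q ^ Suc \<alpha> - 1\<close>. It is congruent to \<open>e\<close> modulo
    \<open>p\<close>, and \<open>e\<close> divides \<open>Suc \<alpha>\<close>, so \<open>p\<close>
    does not divide \<open>G\<close> and all of \<open>p ^ b\<close> falls into
    \<open>q ^ d - 1\<close>.\<close>
  define G where "G = (\<Sum>j<e. (int q ^ d) ^ j)"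
  have G: "int q ^ Suc \<alpha> - 1 = (int q ^ d - 1) * G"
    unfolding G_def e by (simp add: power_diff_1_eq power_mult)
  have "[q ^ d = 1] (mod p)" unfolding d_def by (rule ord)
  then have "[int q ^ d = 1] (mod int p)" by (metis cong_int_iff of_nat_1 of_nat_power)
  then have "[G = (\<Sum>j<e. 1 ^ j)] (mod int p)" unfolding G_def by (intro cong_sum cong_pow)
  then have "[G = int e] (mod int p)" by simp
  moreover have "\<not> int p dvd int e" using n e by auto
  ultimately have "\<not> int p dvd G" using cong_dvd_iff by blast
  then have cop: "coprime (int p ^ b) G"
    using p by (simp add: prime_imp_coprime)
  have nq: "\<not> int p dvd int q - 1"
    using q1 by (metis cong_iff_dvd_diff cong_int_iff of_nat_1)
  have "int q ^ Suc \<alpha> - 1 = int (q - 1) * int (divisor_sum (q ^ \<alpha>))"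
    by (metis pS add_diff_cancel_right' of_nat_1 of_nat_add of_nat_mult of_nat_power)
  then have "int p ^ b dvd (int q ^ d - 1) * G"
    using dvd G by (metis dvd_mult int_dvd_int_iff of_nat_power)
  then have d1: "int p ^ b dvd int q ^ d - 1" using cop by (simp add: coprime_dvd_mult_left_iff)
  have d2: "int q - 1 dvd int q ^ d - 1" by (simp add: power_diff_1_eq)
  have "coprime (int p ^ b) (int q - 1)" using nq p by (simp add: prime_imp_coprime)
  then have "int p ^ b * (int q - 1) dvd int q ^ d - 1" using d1 d2 divides_mult by blast
  moreover have "d > 0" using e by (auto intro: Nat.gr0I)
  then have "int q ^ d > 1" using q3 by (simp add: one_less_power)
  ultimately have "int p ^ b * (int q - 1) \<le> int q ^ d - 1" by (intro zdvd_imp_le) auto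
  also have "int q ^ d \<le> int q ^ l" using \<open>d \<le> l\<close> q3 by (intro power_increasing) auto
  then have "int q ^ d - 1 < int q ^ l" by linarith
  finally have A: "int p ^ b * (int q - 1) < int q ^ l" .
  \<comment> \<open>The factor 2 comes from \<open>q - 1 \<ge> 2\<close>; together with
    \<open>pb\<close> it yields \<open>2 * (p - 1) < p\<close>, impossible for a prime.\<close>
  have "int p ^ b * 2 \<le> int p ^ b * (int q - 1)" using q3 by (intro mult_left_mono) auto
  then have "2 * p ^ b < q ^ l" using A by (simp flip: of_nat_power add: mult.commute)
  then have "(p - 1) * (2 * p ^ b) < (p - 1) * q ^ l" using prime_gt_1_nat[OF p] by simp
  then have "(p - 1) * (2 * p ^ b) < p * p ^ b" using pb by linarith
  then have "((p - 1) * 2) * p ^ b < p * p ^ b" by (simp only: mult.assoc)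
  then have "(p - 1) * 2 < p" by simp
  then show False using prime_gt_1_nat[OF p] by simp
qed

text \<open>Supplies the size hypothesis of \<open>prime_divisor_geometric_sum\<close> for both
  \<open>x = q\<close> and \<open>x = - q\<close>.\<close>

lemma power_ge_mult_Suc:
  fixes q r :: nat
  assumes "q \<ge> 3" "r \<ge> 3"
  shows "q ^ r \<ge> r * (q + 1)"
  using assms(2)
proof (induction r rule: dec_induct)
  case base
  have "3 * (q + 1) \<le> 3 * 3 * q" using assms(1) by simp
  also have "\<dots> \<le> q * q * q" using assms(1) by (intro mult_right_mono mult_mono) auto
  finally show ?case by (simp add: power3_eq_cube)
next
  case (step r)
  have "Suc r * (q + 1) \<le> (3 * r) * (q + 1)" using step.hyps by (intro mult_right_mono) auto
  also have "\<dots> = 3 * (r * (q + 1))" by simp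
  also have "\<dots> \<le> q * q ^ r" using step.IH assms(1) by (intro mult_mono) auto
  finally show ?case by simp
qed

text \<open>The terms group in fours, each group a multiple of
  \<open>(1 + q) * (1 + q\<^sup>2)\<close>, a product of two even numbers.\<close>

lemma four_dvd_divisor_sum_prime_power:
  assumes "prime q" "odd q" "4 dvd Suc \<alpha>"
  shows "4 dvd divisor_sum (q ^ \<alpha>)"
proof -
  obtain c where "Suc \<alpha> = 4 * c" using assms(3) by blast
  then obtain c where c: "\<alpha> = 4 * c + 3" by (cases c) auto
  have "(\<Sum>i\<le>4 * c + 3. q ^ i) = ((1 + q) * (1 + q\<^sup>2)) * (\<Sum>i\<le>c. q ^ (4 * i))"
    by (induction c) (auto simp: algebra_simps eval_nat_numeral power_add)
  moreover have "2 * 2 dvd (1 + q) * (1 + q\<^sup>2)" using assms(2) by (intro mult_dvd_mono) auto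
  then have "4 dvd (1 + q) * (1 + q\<^sup>2)" by simp
  ultimately show ?thesis by (simp only: divisor_sum_prime_power[OF assms(1)] c) (rule dvd_mult2)
qed

text \<open>The three indices are treated together: all that matters is that \<open>m\<close> is 1
  or a prime and that \<open>m\<close> is less than 7.\<close>

lemma no_small_odd_index:
  fixes m :: nat
  assumes q: "prime q" "odd q" and M: "odd M" "\<not> q dvd M"
    and sM: "divisor_sum M = m * q ^ \<alpha>" and sq: "m * divisor_sum (q ^ \<alpha>) = 2 * M"
    and m: "odd m" "m \<le> 5"
  shows False
proof -
  define s where "s x = divisor_sum (x ^ multiplicity x M)" for x
  define n where "n = Suc \<alpha>"
  have M0: "M > 0" using M(1) odd_pos by blast
  have m_cases: "m = 1 \<or> prime m"
  proof -
    have "m = 1 \<or> m = 3 \<or> m = 5" using m by presburger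
    then show ?thesis by (auto simp: prime_nat_numeral_eq)
  qed
  have m0: "m > 0" using m(1) odd_pos by blast
  have q3: "q \<ge> 3" using q prime_ge_2_nat[of q] by (cases "q = 2") auto
  have mM: "m dvd M" using sq m(1) by (metis coprime_right_2_iff_odd coprime_dvd_mult_right_iff dvd_triv_left)
  then have "\<not> q dvd m" using M(2) dvd_trans by blast
  then have cqm: "coprime q m" using q(1) by (simp add: prime_imp_coprime)
  have pf: "prime x" "odd x" "x dvd M" if "x \<in> prime_factors M" for x
    using that M by (auto simp: in_prime_factors_iff)
  have sx_dvd: "s x dvd m * q ^ \<alpha>" if "x \<in> prime_factors M" for x
    using divisor_sum_prime_part_dvd[OF M0 that] sM by (simp add: s_def)
  have two_dvd: "s x * s y dvd m * q ^ \<alpha>"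
    if "x \<in> prime_factors M" "y \<in> prime_factors M" "x \<noteq> y" for x y
    using divisor_sum_two_prime_parts_dvd[OF M0 that] sM by (simp add: s_def)
  \<comment> \<open>All exponents are even because \<open>s x\<close> divides the odd number
    \<open>m * q ^ \<alpha>\<close>.\<close>
  have mult2: "multiplicity x M \<ge> 2" if x: "x \<in> prime_factors M" for x
  proof -
    have "odd (m * q ^ \<alpha>)" using m(1) q(2) by simp
    then have "odd (s x)" using sx_dvd[OF x] dvd_trans by blast
    then have "even (multiplicity x M)"
      using even_divisor_sum_odd_prime_power[of x] pf[OF x] by (simp add: s_def)
    moreover have "multiplicity x M > 0" using x by (auto simp: prime_factors_multiplicity)
    ultimately show ?thesis by presburger
  qed
  have sx_gt: "x ^ multiplicity x M < s x" if x: "x \<in> prime_factors M" for x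
    unfolding s_def using divisor_sum_prime_power_gt pf(1)[OF x] mult2[OF x] by simp
  have "even (divisor_sum (q ^ \<alpha>))"
    using sq m(1) by (metis dvd_triv_left even_mult_iff)
  then have "odd \<alpha>" using even_divisor_sum_odd_prime_power q by blast
  have n4: "\<not> 4 dvd n"
  proof
    assume "4 dvd n"
    then have "4 dvd m * divisor_sum (q ^ \<alpha>)"
      using four_dvd_divisor_sum_prime_power[OF q] by (simp add: n_def)
    then have "2 * 2 dvd 2 * M" using sq by simp
    then show False using M(1) by simp
  qed
  have "even n" using \<open>odd \<alpha>\<close> by (simp add: n_def)
  show False
  proof (cases "n = 2")
    case True
    then have a1: "\<alpha> = 1" by (simp add: n_def)
    \<comment> \<open>Otherwise \<open>s x\<close> would divide \<open>m \<le> 5\<close>, although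
      it exceeds \<open>x ^ 2 \<ge> 9\<close>.\<close>
    have q_dvd: "q dvd s x" if x: "x \<in> prime_factors M" for x
    proof (rule ccontr)
      assume "\<not> q dvd s x"
      then have "coprime (s x) q" using q(1) by (simp add: prime_imp_coprime coprime_commute)
      then have "s x dvd m" using sx_dvd[OF x] a1 by (simp add: coprime_dvd_mult_left_iff)
      then have "s x \<le> 5" using m(2) m0 dvd_imp_le[of "s x" m] by linarith
      moreover have "x \<ge> 3" using pf[OF x] prime_ge_2_nat[of x] by (cases "x = 2") auto
      then have "3 ^ 2 \<le> x ^ 2" by (intro power_mono) auto
      moreover have "x ^ 2 \<le> x ^ multiplicity x M"
        using mult2[OF x] prime_ge_1_nat[OF pf(1)[OF x]] by (intro power_increasing)
      ultimately show False using sx_gt[OF x] by simp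
    qed
    have "M \<noteq> 1"
    proof
      assume "M = 1"
      then have "m * q = 1" using sM a1 by (simp add: divisor_sum_def)
      then show False using q3 by simp
    qed
    then obtain x where x: "x \<in> prime_factors M"
      using M0 prime_factor_nat[of M] by (auto simp: in_prime_factors_iff)
    have "y = x" if y: "y \<in> prime_factors M" for y
    proof (rule ccontr)
      assume "y \<noteq> x"
      then have "s x * s y dvd m * q" using two_dvd[OF x y] a1 by simp
      then have "q * q dvd m * q" using q_dvd[OF x] q_dvd[OF y] by (meson mult_dvd_mono dvd_trans)
      then have "q dvd m" using q3 by simp
      then show False using \<open>\<not> q dvd m\<close> by blast
    qed
    then have "prime_factors M = {x}" using x by blast
    then have Mx: "M = x ^ multiplicity x M"
      using prime_factorization_nat[OF M0] by simp
    then have s: "s x = m * q" using sM a1 by (simp add: s_def)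
    \<comment> \<open>A prime \<open>m\<close> divides \<open>M\<close>, so it would equal
      \<open>x\<close>; but \<open>s x = m * q\<close> is 1 modulo \<open>x\<close>.\<close>
    have "m = 1"
    proof (rule ccontr)
      assume "m \<noteq> 1"
      then have "prime m" using m_cases by blast
      moreover have "m dvd x ^ multiplicity x M" using mM Mx by simp
      ultimately have "m = x" using pf(1)[OF x] prime_dvd_power primes_dvd_imp_eq by blast
      then have "[m * q = 1] (mod m)"
        using divisor_sum_prime_power_cong_1[OF pf(1)[OF x]] s by (metis s_def)
      then have "m dvd 1" using cong_dvd_iff[of "m * q" 1 m] by simp
      then show False using \<open>m \<noteq> 1\<close> by simp
    qed
    have "divisor_sum (q ^ 1) = q + 1" by (simp only: divisor_sum_prime_power[OF q(1)]) simp
    then have 1: "q + 1 = 2 * M" using sq a1 \<open>m = 1\<close> by simp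
    have "(x - 1) * q + 1 = x * M"
      using divisor_sum_prime_power_eq[OF pf(1)[OF x], of "multiplicity x M"] s \<open>m = 1\<close> Mx
      by (simp add: s_def)
    then have "2 * ((x - 1) * q + 1) = x * (q + 1)" using 1 by simp
    \<comment> \<open>Eliminating \<open>M\<close> leaves \<open>(x - 2) * q = x - 2\<close>; here
      \<open>Suc u\<close> is \<open>x - 2\<close>, which is positive.\<close>
    moreover obtain u where u: "x = u + 3"
      using pf[OF x] prime_ge_2_nat[of x] le_Suc_ex[of 3 x] by (cases "x = 2") (auto simp: add.commute)
    ultimately have "Suc u * q = Suc u * 1" by (simp add: algebra_simps)
    then have "q = 1" by (simp only: Suc_mult_cancel1)
    then show False using q3 by simp
  next
    case False
    obtain k where k: "n = 2 * k" using \<open>even n\<close> by blast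
    have "odd k" using n4 k by auto
    have "k \<noteq> 1" using False k by simp
    then obtain r0 where r0: "prime r0" "r0 dvd k" using prime_factor_nat by blast
    define A where "A = {r. prime r \<and> odd r \<and> r dvd n}"
    have "r0 \<in> A" using r0 \<open>odd k\<close> k by (auto simp: A_def)
    have "finite A" by (rule finite_subset[of _ "{d. d dvd n}"]) (auto simp: A_def n_def)
    define r where "r = Max A"
    have "r \<in> A" unfolding r_def using \<open>finite A\<close> \<open>r0 \<in> A\<close> by (intro Max_in) auto
    then have r: "prime r" "odd r" "r dvd n" by (auto simp: A_def)
    have r3: "r \<ge> 3" using r prime_ge_2_nat[of r] by (cases "r = 2") auto
    have rn: "2 * r dvd n" using r \<open>even n\<close> by (intro divides_mult) auto
    have qr: "q ^ r \<ge> r * (q + 1)" by (rule power_ge_mult_Suc[OF q3 r3])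
    \<comment> \<open>Such a \<open>p\<close> is at least \<open>2 * r + 1\<close>, hence above the
      maximum \<open>r\<close> of \<open>A\<close>. The bound 7 keeps \<open>p\<close> away from
      \<open>m\<close>.\<close>
    have p_props: "p \<ge> 7 \<and> \<not> p dvd n" if p: "prime p" "[p = 1] (mod r)" for p
    proof -
      have "r dvd p - 1" using p prime_gt_0_nat[of p] by (simp add: cong_altdef_nat)
      have "odd p"
      proof
        assume "even p"
        then have "p = 2" using p(1) primes_dvd_imp_eq two_is_prime_nat by blast
        then show False using \<open>r dvd p - 1\<close> r3 by simp
      qed
      then have "2 dvd p - 1" by simp
      then have "2 * r dvd p - 1" using \<open>r dvd p - 1\<close> r(2) by (intro divides_mult) auto
      then have "2 * r \<le> p - 1" using prime_gt_1_nat[OF p(1)] by (intro dvd_imp_le) auto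
      then have "p > r" "p \<ge> 7" using r3 by auto
      moreover have "\<not> p dvd n"
      proof
        assume "p dvd n"
        then have "p \<in> A" using p(1) \<open>odd p\<close> by (simp add: A_def)
        then have "p \<le> r" unfolding r_def using \<open>finite A\<close> by simp
        then show False using \<open>p > r\<close> by simp
      qed
      ultimately show ?thesis by blast
    qed
    \<comment> \<open>As \<open>2 * r\<close> divides \<open>n\<close>, \<open>p\<close> divides
      \<open>divisor_sum (q ^ \<alpha>)\<close> and so \<open>M\<close>. Were \<open>s p\<close>
      coprime to \<open>m\<close>, it would be a power of \<open>q\<close>, which
      \<open>new_prime_divisor_contradiction\<close> excludes.\<close>
    have p_main: "p \<in> prime_factors M \<and> m dvd s p \<and> m \<noteq> 1"
      if p: "prime p" "[p = 1] (mod r)" "\<not> [int q = 1] (mod int p)" "[int q ^ (2 * r) = 1] (mod int p)" for p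
    proof -
      define b where "b = multiplicity p M"
      have p7: "p \<ge> 7" "\<not> p dvd n" using p_props[OF p(1,2)] by auto
      have q1: "\<not> [q = 1] (mod p)" using p(3) by (metis cong_int_iff of_nat_1)
      have cpm: "coprime p m"
        using p7(1) m m0 p(1) by (intro prime_imp_coprime) (auto dest: dvd_imp_le)
      have "[q ^ (2 * r) = 1] (mod p)" using p(4) by (metis cong_int_iff of_nat_1 of_nat_power)
      then have "[q ^ n = 1] (mod p)" using rn unfolding ord_divides using dvd_trans by blast
      moreover have "q ^ n = (q - 1) * divisor_sum (q ^ \<alpha>) + 1"
        unfolding n_def using divisor_sum_prime_power_eq[OF q(1)] by simp
      ultimately have "[(q - 1) * divisor_sum (q ^ \<alpha>) + 1 = 0 + 1] (mod p)" by simp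
      then have "p dvd (q - 1) * divisor_sum (q ^ \<alpha>)"
        by (simp only: cong_add_rcancel_nat cong_0_iff)
      moreover have "\<not> p dvd q - 1"
        using q1 q3 by (simp add: cong_altdef_nat)
      ultimately have "p dvd divisor_sum (q ^ \<alpha>)" using p(1) prime_dvd_mult_iff by blast
      then have "p dvd 2 * M" using sq by (metis dvd_mult)
      moreover have "\<not> p dvd 2" using p7 by (auto dest: dvd_imp_le)
      ultimately have "p dvd M" using p(1) prime_dvd_mult_iff by blast
      then have pM: "p \<in> prime_factors M" using p(1) M0 by (simp add: in_prime_factors_iff)
      have "p ^ b dvd M" unfolding b_def by (rule multiplicity_dvd)
      then have "p ^ b dvd m * divisor_sum (q ^ \<alpha>)" using sq by simp
      then have pb: "p ^ b dvd divisor_sum (q ^ \<alpha>)"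
        using cpm by (simp add: coprime_dvd_mult_right_iff)
      have "\<not> coprime (s p) m"
      proof
        assume "coprime (s p) m"
        then have "s p dvd q ^ \<alpha>" using sx_dvd[OF pM] by (simp add: coprime_dvd_mult_right_iff)
        then obtain l where "s p = q ^ l" using divides_primepow_nat[OF q(1)] by blast
        then show False
          using new_prime_divisor_contradiction[OF p(1) q _ pb _ q1] p7(2) mult2[OF pM]
          by (auto simp: s_def b_def n_def)
      qed
      then have "m \<noteq> 1" by auto
      then have "prime m" using m_cases by blast
      then have "m dvd s p" using \<open>\<not> coprime (s p) m\<close> by (metis prime_imp_coprime coprime_commute)
      then show ?thesis using pM \<open>m \<noteq> 1\<close> by blast
    qed
    have big1: "int r < \<bar>\<Sum>j<r. int q ^ j\<bar>"
    proof -
      have "(int q - 1) * (\<Sum>j<r. int q ^ j) = int q ^ r - 1" by (simp add: power_diff_1_eq)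
      moreover have "int q ^ r \<ge> int r * (int q + 1)"
        using qr by (metis of_nat_1 of_nat_add of_nat_le_iff of_nat_mult of_nat_power)
      ultimately have "(int q - 1) * int r < (int q - 1) * (\<Sum>j<r. int q ^ j)"
        using r3 by (simp add: algebra_simps)
      then show ?thesis using q3 by (simp add: mult_less_cancel_left)
    qed
    \<comment> \<open>Since \<open>r\<close> is odd, this sum is
      \<open>(q ^ r + 1) / (q + 1)\<close>.\<close>
    have big2: "int r < \<bar>\<Sum>j<r. (- int q) ^ j\<bar>"
    proof -
      have "(int q + 1) * (\<Sum>j<r. (- int q) ^ j) = int q ^ r + 1"
        using power_diff_1_eq[of "- int q" r] r(2) by (simp add: algebra_simps)
      moreover have "int q ^ r \<ge> int r * (int q + 1)"
        using qr by (metis of_nat_1 of_nat_add of_nat_le_iff of_nat_mult of_nat_power)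
      ultimately have "(int q + 1) * int r < (int q + 1) * (\<Sum>j<r. (- int q) ^ j)"
        by (simp add: algebra_simps)
      then show ?thesis by (simp add: mult_less_cancel_left)
    qed
    obtain p1 where p1: "prime p1" "[p1 = 1] (mod r)" "[int q ^ r = 1] (mod int p1)" "\<not> [int q = 1] (mod int p1)"
      using prime_divisor_geometric_sum[OF r(1,2) big1] by blast
    obtain p2 where p2: "prime p2" "[p2 = 1] (mod r)" "[(- int q) ^ r = 1] (mod int p2)"
      using prime_divisor_geometric_sum[OF r(1,2) big2] by blast
    have no2: "\<not> [1 = - 1] (mod int p2)"
    proof
      assume "[1 = - 1] (mod int p2)"
      then have "int p2 dvd 2" by (simp add: cong_iff_dvd_diff)
      then have "p2 dvd 2" by (metis int_dvd_int_iff of_nat_numeral)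
      then show False using p_props[OF p2(1,2)] by (auto dest: dvd_imp_le)
    qed
    have "[- 1 * (- int q) ^ r = - 1 * 1] (mod int p2)" using p2(3) by (intro cong_mult) auto
    then have qr2: "[int q ^ r = - 1] (mod int p2)" using r(2) by simp
    have p2': "\<not> [int q ^ r = 1] (mod int p2)"
      using qr2 no2 cong_sym cong_trans by blast
    then have "\<not> [int q = 1] (mod int p2)"
      using cong_pow[of "int q" 1 "int p2" r] by auto
    moreover have "[(int q ^ r) ^ 2 = (- 1) ^ 2] (mod int p2)" using qr2 by (rule cong_pow)
    then have "[int q ^ (2 * r) = 1] (mod int p2)" by (simp add: power_mult[symmetric] mult.commute)
    ultimately have P2: "p2 \<in> prime_factors M" "m dvd s p2" "m \<noteq> 1"
      using p_main[OF p2(1,2)] by auto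
    have "[(int q ^ r) ^ 2 = 1 ^ 2] (mod int p1)" using p1(3) by (rule cong_pow)
    then have "[int q ^ (2 * r) = 1] (mod int p1)" by (simp add: power_mult[symmetric] mult.commute)
    then have P1: "p1 \<in> prime_factors M" "m dvd s p1"
      using p_main[OF p1(1,2,4)] by auto
    \<comment> \<open>\<open>q ^ r\<close> is 1 modulo \<open>p1\<close> but -1 modulo
      \<open>p2\<close>, and \<open>p2\<close> is not 2. The two exceptions put \<open>m\<close>
      twice into \<open>m * q ^ \<alpha>\<close>, although \<open>m\<close> is coprime to
      \<open>q\<close>.\<close>
    have "p1 \<noteq> p2" using p1(3) p2' by auto
    then have "s p1 * s p2 dvd m * q ^ \<alpha>" using two_dvd P1 P2 by blast
    then have "m * m dvd m * q ^ \<alpha>" using P1(2) P2(2) by (meson mult_dvd_mono dvd_trans)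
    then have "m dvd q ^ \<alpha>" using m0 by simp
    moreover have "coprime m (q ^ \<alpha>)" using cqm by (simp add: coprime_commute)
    ultimately show False using P2(3) by (meson coprime_absorb_left nat_dvd_1_iff_1)
  qed
qed

section \<open>The bound for odd perfect numbers\<close>

theorem theorem1p1:
  fixes N q \<alpha> :: nat
  assumes "odd N" and "perfect_number N"
    and "prime q" and "\<alpha> \<ge> 1" and "exact_power_dvd q \<alpha> N"
  shows "real (divisor_sum (N div q ^ \<alpha>)) / real (q ^ \<alpha>) > 5"
proof -
  define M where "M = N div q ^ \<alpha>"
  have N: "N = q ^ \<alpha> * M" using assms(5) by (simp add: M_def exact_power_dvd_def)
  have qM: "\<not> q dvd M" using assms(5) N by (auto simp: exact_power_dvd_def mult.commute)
  have odd: "odd q" "odd M" using assms(1,4) N by auto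
  have q0: "q > 0" using assms(3) prime_gt_0_nat by blast
  have "M > 0" using odd(2) odd_pos by blast
  have "coprime (q ^ \<alpha>) M" using qM assms(3) by (simp add: prime_imp_coprime)
  then have "divisor_sum (q ^ \<alpha>) * divisor_sum M = divisor_sum N"
    using N divisor_sum_mult[of "q ^ \<alpha>" M] q0 \<open>M > 0\<close> by simp
  then have eq: "divisor_sum (q ^ \<alpha>) * divisor_sum M = q ^ \<alpha> * (2 * M)"
    using assms(2) N by (simp add: perfect_number_def)
  \<comment> \<open>Coprimality of \<open>q ^ \<alpha>\<close> and its divisor sum makes the
    quotient in question an integer \<open>m\<close>, so it suffices to exclude
    \<open>m \<le> 5\<close>.\<close>
  have "\<not> q dvd divisor_sum (q ^ \<alpha>)"
    using cong_dvd_iff[OF divisor_sum_prime_power_cong_1[OF assms(3), of \<alpha>]] assms(3) by (auto dest: not_prime_unit)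
  then have "coprime (q ^ \<alpha>) (divisor_sum (q ^ \<alpha>))"
    using assms(3) by (simp add: prime_imp_coprime)
  then have "q ^ \<alpha> dvd divisor_sum M"
    using eq by (metis coprime_dvd_mult_right_iff dvd_triv_left)
  then obtain m where m: "divisor_sum M = m * q ^ \<alpha>" by (metis dvdE mult.commute)
  have "q ^ \<alpha> * (m * divisor_sum (q ^ \<alpha>)) = q ^ \<alpha> * (2 * M)" using eq m by (simp add: ac_simps)
  then have sq: "m * divisor_sum (q ^ \<alpha>) = 2 * M" using q0 by simp
  have "m > 5"
  proof (rule ccontr)
    assume "\<not> m > 5"
    then have m5: "m \<le> 5" by simp
    have "even m"
      using no_small_odd_index[OF assms(3) odd qM m sq] m5 by blast
    then have "m = 0 \<or> m = 2 \<or> m = 4" using m5 by presburger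
    then consider "m = 0" | "m = 2" | "m = 4" by blast
    then show False
    proof cases
      case 1
      then show False using sq \<open>M > 0\<close> by simp
    next
      case 2
      then show False using no_even_index_two[OF assms(3) odd, of \<alpha>] sq m by simp
    next
      case 3
      then have "M = 2 * divisor_sum (q ^ \<alpha>)" using sq by simp
      then show False using odd(2) by simp
    qed
  qed
  moreover have "real (divisor_sum M) / real (q ^ \<alpha>) = real m"
    using m q0 by simp
  ultimately show ?thesis unfolding M_def by simp
qed

end
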